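(* Let $T\in\mathbb{N}$, $T\ge 2$. The kernel $\widetilde k_{\alpha,\beta}$ of the operator $(\overline W^T)^{-1}$, that is, the numbers $\widetilde k_{\alpha,\beta}=\big((\overline W^T)^{-1}\big)_{\alpha,\beta+1}$, $1\le\alpha\le\beta\le T-1$, satisfies the equation $$\widetilde k_{\beta,T-1}+\sum_{j=1}^{T-1}\widetilde C^T_{\beta,j}\,\widetilde k_{j,T-1}+\widetilde C^T_{\beta,T}=0,\qquad \beta=1,\ldots,T-1,$$ where $\widetilde C^T=\overline C^T-I$ and $\overline C^T$ is the $T\times T$ matrix with entries $\overline C^T_{ij}=C^T_{T+1-j,T+1-i}$, with $$C^T_{ij}=\sum_{k=0}^{T-\max\{i,j\}}r_{|i-j|+2k},\qquad i,j=1,\ldots,T,\quad r_0=1 .$$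
   Context: $\mathbb{N}=\{1,2,\ldots\}$, $\mathbb{N}_0=\mathbb{N}\cup\{0\}$. Fix a real sequence (potential) $(b_1,b_2,\ldots)$. For a real control $f=(f_0,f_1,\ldots)$, $u^f_{n,t}$ denotes the solution of $$u_{n,t+1}+u_{n,t-1}-u_{n+1,t}-u_{n-1,t}+b_nu_{n,t}=0\quad (n\in\mathbb{N},\ t\in\mathbb{N}_0),$$ $$u_{n,-1}=u_{n,0}=0\ (n\in\mathbb{N}),\qquad u_{0,t}=f_t\ (t\in\mathbb{N}_0).$$ The response vector $(r_0,r_1,r_2,\ldots)$, with $r_0=1$, is the sequence such that $u^f_{1,t}=\sum_{s=0}^{t-1}r_sf_{t-1-s}$ for all controls $f$ and all $t\ge1$; equivalently $r_s=u^\delta_{1,s+1}$ for $\delta=(1,0,0,\ldots)$. The control operator is $W^T:\mathbb{R}^T\to\mathbb{R}^T$, $(W^Tf)_n=u^f_{n,T}$, $n=1,\ldots,T$, where $f=(f_0,\ldots,f_{T-1})$ (the values $u^f_{n,T}$, $n\ge 1$, depend only on these components). Let $J$ be the reversal $(Jf)_n=f_{T-1-n}$, $n=0,\ldots,T-1$, and define the $T\times T$ matrix $\overline W^T$ by $W^T=\overline W^TJ$. The matrix $\overline W^T$ is upper triangular with ones on the diagonal, hence invertible, and its inverse has the form $$(\overline W^T)^{-1}=\begin{pmatrix}1&\widetilde k_{1,1}&\widetilde k_{1,2}&\ldots&\widetilde k_{1,T-1}\\0&1&\widetilde k_{2,2}&\ldots&\widetilde k_{2,T-1}\\ \cdot&\cdot&\cdot&\cdot&\cdot\\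 0&\ldots&0&1&\widetilde k_{T-1,T-1}\\0&\ldots&\ldots&0&1\end{pmatrix}.$$ *)

theory Defs
  imports
    Complex_Main
    "Jordan_Normal_Form.Matrix"
    "Jordan_Normal_Form.Determinant"
    "Jordan_Normal_Form.Gauss_Jordan_Elimination"
begin

text \<open>Positions are natural numbers, with \<open>0\<close> the boundary point; times are integers, since the
  initial data live at times \<open>-1\<close> and \<open>0\<close>. The potential is \<open>b 1, b 2, \<dots>\<close>; the value \<open>b 0\<close> and
  the values of a solution outside the space-time domain below are irrelevant.\<close>

definition wave_system :: "(nat \<Rightarrow> real) \<Rightarrow> (nat \<Rightarrow> real) \<Rightarrow> (nat \<Rightarrow> int \<Rightarrow> real) \<Rightarrow> bool" where
  "wave_system b f u \<longleftrightarrow>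
     (\<forall>n\<ge>1. \<forall>t\<ge>0. u n (t + 1) + u n (t - 1) - u (n + 1) t - u (n - 1) t + b n * u n t = 0) \<and>
     (\<forall>n\<ge>1. u n (-1) = 0 \<and> u n 0 = 0) \<and>
     (\<forall>t. u 0 (int t) = f t)"

definition wave :: "(nat \<Rightarrow> real) \<Rightarrow> (nat \<Rightarrow> real) \<Rightarrow> nat \<Rightarrow> int \<Rightarrow> real" where
  "wave b f = (SOME u. wave_system b f u)"

text \<open>The choice in \<open>wave\<close> is harmless: a solution exists and is unique on its domain.\<close>

fun wave_rec :: "(nat \<Rightarrow> real) \<Rightarrow> (nat \<Rightarrow> real) \<Rightarrow> nat \<Rightarrow> nat \<Rightarrow> real" where
  "wave_rec b f 0 s = f (s - 1)"
| "wave_rec b f (Suc n) 0 = 0"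
| "wave_rec b f (Suc n) (Suc 0) = 0"
| "wave_rec b f (Suc n) (Suc (Suc s)) =
     wave_rec b f (Suc (Suc n)) (Suc s) + wave_rec b f n (Suc s)
     - b (Suc n) * wave_rec b f (Suc n) (Suc s) - wave_rec b f (Suc n) s"

lemma wave_system_exists: "\<exists>u. wave_system b f u"
proof
  have "wave_rec b f n (nat (t + 1 + 1)) + wave_rec b f n (nat (t - 1 + 1))
      - wave_rec b f (n + 1) (nat (t + 1)) - wave_rec b f (n - 1) (nat (t + 1))
      + b n * wave_rec b f n (nat (t + 1)) = 0" if "n \<ge> 1" "t \<ge> 0" for n :: nat and t :: int
  proof -
    obtain m where n: "n = Suc m" using \<open>n \<ge> 1\<close> by (cases n) auto
    obtain k where t: "t = int k" using \<open>t \<ge> 0\<close> nonneg_int_cases by blast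
    have "nat (int k + 1 + 1) = Suc (Suc k)" "nat (int k - 1 + 1) = k" "nat (int k + 1) = Suc k"
      by auto
    then show ?thesis by (simp only: n t) simp
  qed
  moreover have "wave_rec b f n (nat (-1 + 1)) = 0 \<and> wave_rec b f n (nat (0 + 1)) = 0"
    if "n \<ge> 1" for n
    using that by (cases n) auto
  ultimately show "wave_system b f (\<lambda>n t. wave_rec b f n (nat (t + 1)))"
    unfolding wave_system_def by (auto simp: nat_add_distrib)
qed

lemma wave_system_wave: "wave_system b f (wave b f)"
  unfolding wave_def using wave_system_exists by (rule someI_ex)

lemma wave_system_step:
  assumes "wave_system b f u" "n \<ge> 1"
  shows "u n (int (Suc t)) =
    u (n + 1) (int t) + u (n - 1) (int t) - b n * u n (int t) - u n (int t - 1)"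
proof -
  have "u n (int t + 1) + u n (int t - 1) - u (n + 1) (int t) - u (n - 1) (int t) + b n * u n (int t) = 0"
    using assms unfolding wave_system_def by simp
  moreover have "int (Suc t) = int t + 1" by simp
  ultimately show ?thesis by (simp only:)
qed

lemma wave_system_unique:
  assumes u: "wave_system b f u" and v: "wave_system b f v"
  shows "u n (int t) = v n (int t)"
proof (induction t arbitrary: n rule: less_induct)
  case (less t)
  have b0: "u 0 (int s) = v 0 (int s)" for s using u v by (auto simp: wave_system_def)
  show ?case
  proof (cases "n = 0")
    case True then show ?thesis using b0 by simp
  next
    case False
    then have n: "n \<ge> 1" by simp
    show ?thesis
    proof (cases t)
      case 0 then show ?thesis using u v n by (simp add: wave_system_def)
    next
      case (Suc k)
      have "u n (int k - 1) = v n (int k - 1)"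
      proof (cases k)
        case 0 then show ?thesis using u v n by (simp add: wave_system_def)
      next
        case (Suc j)
        then have "int k - 1 = int j" by simp
        then show ?thesis using less.IH[of j n] \<open>t = Suc k\<close> Suc by simp
      qed
      moreover have "u m (int k) = v m (int k)" for m using less.IH[of k m] Suc by simp
      ultimately show ?thesis
        unfolding Suc wave_system_step[OF u n] wave_system_step[OF v n] by simp
    qed
  qed
qed

definition response :: "(nat \<Rightarrow> real) \<Rightarrow> nat \<Rightarrow> real" where
  "response b s = wave b (\<lambda>t. if t = 0 then 1 else 0) 1 (int s + 1)"

definition control_of_vec :: "real vec \<Rightarrow> nat \<Rightarrow> real" where
  "control_of_vec g t = (if t < dim_vec g then g $ t else 0)"

definition control_operator :: "(nat \<Rightarrow> real) \<Rightarrow> nat \<Rightarrow> real vec \<Rightarrow> real vec" where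
  "control_operator b T g = vec T (\<lambda>i. wave b (control_of_vec g) (i + 1) (int T))"

definition reversal :: "nat \<Rightarrow> real vec \<Rightarrow> real vec" where
  "reversal T g = vec T (\<lambda>i. g $ (T - 1 - i))"

text \<open>Since the reversal is an involution, the matrix \<open>W_bar\<close> with
  \<open>control_operator b T g = W_bar b T *\<^sub>v reversal T g\<close> is the matrix, in the standard basis, of
  the control operator composed with the reversal; see \<open>control_operator_eq_W_bar\<close>.\<close>

definition W_bar :: "(nat \<Rightarrow> real) \<Rightarrow> nat \<Rightarrow> real mat" where
  "W_bar b T = mat T T (\<lambda>(i, j). control_operator b T (reversal T (unit_vec T j)) $ i)"

text \<open>Library matrices are indexed from \<open>0\<close>; \<open>entry\<close> reads them with indices starting at \<open>1\<close>.\<close>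

definition entry :: "real mat \<Rightarrow> nat \<Rightarrow> nat \<Rightarrow> real" where
  "entry A i j = A $$ (i - 1, j - 1)"

definition k_tilde :: "(nat \<Rightarrow> real) \<Rightarrow> nat \<Rightarrow> nat \<Rightarrow> nat \<Rightarrow> real" where
  "k_tilde b T \<alpha> \<beta> = entry (the (mat_inverse (W_bar b T))) \<alpha> (\<beta> + 1)"

definition C_mat :: "(nat \<Rightarrow> real) \<Rightarrow> nat \<Rightarrow> real mat" where
  "C_mat b T = mat T T (\<lambda>(i, j). let i' = i + 1; j' = j + 1 in
     \<Sum>k = 0..T - max i' j'. response b (nat \<bar>int i' - int j'\<bar> + 2 * k))"

definition C_bar :: "(nat \<Rightarrow> real) \<Rightarrow> nat \<Rightarrow> real mat" where
  "C_bar b T = mat T T (\<lambda>(i, j). let i' = i + 1; j' = j + 1 in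
     entry (C_mat b T) (T + 1 - j') (T + 1 - i'))"

definition C_tilde :: "(nat \<Rightarrow> real) \<Rightarrow> nat \<Rightarrow> real mat" where
  "C_tilde b T = C_bar b T - 1\<^sub>m T"

subsection \<open>Well-definedness\<close>

lemma wave_boundary: "wave b f 0 (int t) = f t"
  and wave_initial: "n \<ge> 1 \<Longrightarrow> wave b f n (-1) = 0" "n \<ge> 1 \<Longrightarrow> wave b f n 0 = 0"
  using wave_system_wave[of b f] by (auto simp: wave_system_def)

lemma wave_step:
  assumes "n \<ge> 1"
  shows "wave b f n (int (Suc t)) = wave b f (n + 1) (int t) + wave b f (n - 1) (int t)
    - b n * wave b f n (int t) - wave b f n (int t - 1)"
  by (rule wave_system_step[OF wave_system_wave assms])

abbreviation impulse :: "nat \<Rightarrow> real" where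
  "impulse \<equiv> (\<lambda>t. if t = 0 then 1 else 0)"

lemma wave_duhamel:
  "wave b f n (int t) = (\<Sum>s\<le>t. wave b impulse n (int (t - s)) * f s)"
proof (induction t arbitrary: n rule: less_induct)
  case (less t)
  let ?d = "wave b impulse"
  show ?case
  proof (cases "n = 0")
    case True
    have "(\<Sum>s\<le>t. ?d 0 (int (t - s)) * f s) = (\<Sum>s\<le>t. if s = t then f s else 0)"
      by (rule sum.cong) (auto simp: wave_boundary simp del: of_nat_diff)
    then show ?thesis using True by (simp add: wave_boundary del: of_nat_diff)
  next
    case False
    then have n: "n \<ge> 1" by simp
    show ?thesis
    proof (cases t)
      case 0 then show ?thesis using wave_initial(2)[OF n] by simp
    next
      case (Suc k)
      have prev: "wave b f n (int k - 1) = (\<Sum>s\<le>k. ?d n (int (k - s) - 1) * f s)"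
      proof (cases k)
        case 0 then show ?thesis using wave_initial(1)[OF n] by simp
      next
        case (Suc j)
        have "(\<Sum>s\<le>k. ?d n (int (k - s) - 1) * f s) = (\<Sum>s\<le>j. ?d n (int (k - s) - 1) * f s)"
          using wave_initial(1)[OF n] Suc by simp
        also have "\<dots> = (\<Sum>s\<le>j. ?d n (int (j - s)) * f s)"
          by (rule sum.cong) (auto simp: Suc)
        also have "\<dots> = wave b f n (int j)" using less.IH[of j n] Suc \<open>t = Suc k\<close> by simp
        finally show ?thesis using Suc by simp
      qed
      have IH: "wave b f m (int k) = (\<Sum>s\<le>k. ?d m (int (k - s)) * f s)" for m
        using less.IH[of k m] Suc by simp
      have "(\<Sum>s\<le>t. ?d n (int (t - s)) * f s) = (\<Sum>s\<le>k. ?d n (int (t - s)) * f s)"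
        using wave_initial(2)[OF n] Suc by simp
      also have "\<dots> = (\<Sum>s\<le>k. ?d n (int (Suc (k - s))) * f s)"
        by (rule sum.cong) (auto simp: Suc Suc_diff_le simp del: of_nat_diff of_nat_Suc)
      also have "\<dots> = (\<Sum>s\<le>k. ?d (n + 1) (int (k - s)) * f s + ?d (n - 1) (int (k - s)) * f s
          - b n * (?d n (int (k - s)) * f s) - ?d n (int (k - s) - 1) * f s)"
        unfolding wave_step[OF n] by (simp add: algebra_simps)
      also have "\<dots> = wave b f n (int t)"
        unfolding Suc wave_step[OF n] IH prev by (simp add: sum.distrib sum_subtractf sum_distrib_left)
      finally show ?thesis by simp
    qed
  qed
qed

lemma response_0: "response b 0 = 1"
  using wave_step[of 1 b impulse 0] wave_boundary[of b impulse 0]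
    wave_initial[of 1 b impulse] wave_initial[of 2 b impulse]
  by (simp add: response_def numeral_2_eq_2)

lemma response_convolution:
  assumes "t \<ge> 1"
  shows "wave b f 1 (int t) = (\<Sum>s = 0..t - 1. response b s * f (t - 1 - s))"
proof -
  obtain k where t: "t = Suc k" using assms by (cases t) auto
  have "wave b f 1 (int t) = (\<Sum>s\<le>k. wave b impulse 1 (int (t - s)) * f s)"
    unfolding wave_duhamel[of b f] using wave_initial(2)[of 1 b impulse] by (simp add: t)
  also have "\<dots> = (\<Sum>s\<le>k. response b (k - s) * f s)"
    unfolding response_def by (rule sum.cong) (auto simp: t algebra_simps)
  also have "\<dots> = (\<Sum>s\<le>k. response b s * f (k - s))"
    by (rule sum.reindex_bij_witness[of _ "\<lambda>s. k - s" "\<lambda>s. k - s"]) auto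
  finally show ?thesis by (simp add: t atLeast0AtMost)
qed

lemma wave_impulse_front:
  "(t < n \<longrightarrow> wave b impulse n (int t) = 0) \<and> (t = n \<longrightarrow> wave b impulse n (int t) = 1)"
proof (induction t arbitrary: n rule: less_induct)
  case (less t)
  show ?case
  proof (cases "n = 0 \<or> t = 0")
    case True then show ?thesis using wave_boundary[of b impulse 0] wave_initial(2)[of n b impulse] by auto
  next
    case False
    then obtain k where t: "t = Suc k" and n: "n \<ge> 1" by (cases t) auto
    have prev: "wave b impulse n (int k - 1) = 0" if "k < Suc n"
    proof (cases k)
      case 0 then show ?thesis using wave_initial(1)[OF n] by simp
    next
      case (Suc j) then show ?thesis using less.IH[of j n] that t by simp
    qed
    show ?thesis
      unfolding t wave_step[OF n]
      using less.IH[of k "n + 1"] less.IH[of k n] less.IH[of k "n - 1"] prev t n by auto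
  qed
qed

lemma W_bar_entry:
  assumes "i < T" "j < T"
  shows "W_bar b T $$ (i, j) = wave b impulse (i + 1) (int (j + 1))"
proof -
  let ?f = "control_of_vec (reversal T (unit_vec T j))"
  have f: "?f s = (if s = T - 1 - j then 1 else 0)" for s
    using assms by (auto simp: control_of_vec_def reversal_def unit_vec_def)
  have "W_bar b T $$ (i, j) = (\<Sum>s\<le>T. wave b impulse (i + 1) (int (T - s)) * ?f s)"
    using assms unfolding W_bar_def control_operator_def
    by (simp add: wave_duhamel[symmetric] del: of_nat_diff)
  also have "\<dots> = (\<Sum>s\<le>T. if s = T - 1 - j then wave b impulse (i + 1) (int (T - s)) else 0)"
    by (rule sum.cong) (auto simp: f)
  also have "\<dots> = wave b impulse (i + 1) (int (T - (T - 1 - j)))"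
    using assms by (simp del: of_nat_diff)
  also have "T - (T - 1 - j) = j + 1" using assms by simp
  finally show ?thesis .
qed

lemma control_operator_eq_W_bar:
  assumes "g \<in> carrier_vec T"
  shows "control_operator b T g = W_bar b T *\<^sub>v reversal T g"
proof (rule eq_vecI)
  fix i assume "i < dim_vec (W_bar b T *\<^sub>v reversal T g)"
  then have i: "i < T" by (simp add: W_bar_def)
  have dim: "dim_vec g = T" using assms by simp
  have "control_operator b T g $ i = (\<Sum>s\<le>T. wave b impulse (i + 1) (int (T - s)) * control_of_vec g s)"
    using i unfolding control_operator_def by (simp add: wave_duhamel[symmetric] del: of_nat_diff)
  also have "\<dots> = (\<Sum>s<T. wave b impulse (i + 1) (int (T - s)) * g $ s)"
    unfolding lessThan_Suc_atMost[symmetric] by (simp add: control_of_vec_def dim)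
  also have "\<dots> = (\<Sum>j<T. wave b impulse (i + 1) (int (j + 1)) * g $ (T - 1 - j))"
    by (rule sum.reindex_bij_witness[of _ "\<lambda>j. T - 1 - j" "\<lambda>j. T - 1 - j"]) auto
  also have "\<dots> = (\<Sum>j<T. W_bar b T $$ (i, j) * reversal T g $ j)"
    by (rule sum.cong) (auto simp: W_bar_entry[OF i] reversal_def)
  also have "\<dots> = (W_bar b T *\<^sub>v reversal T g) $ i"
    using i by (simp add: scalar_prod_def W_bar_def reversal_def atLeast0LessThan)
  finally show "control_operator b T g $ i = (W_bar b T *\<^sub>v reversal T g) $ i" .
qed (simp add: control_operator_def W_bar_def)

lemma W_bar_unitriangular:
  "W_bar b T \<in> carrier_mat T T"
  "upper_triangular (W_bar b T)"
  "i < T \<Longrightarrow> W_bar b T $$ (i, i) = 1"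
proof -
  show c: "W_bar b T \<in> carrier_mat T T" by (simp add: W_bar_def)
  show "upper_triangular (W_bar b T)"
    unfolding upper_triangular_def
  proof (intro allI impI)
    fix i j assume "i < dim_row (W_bar b T)" "j < i"
    then have "i < T" "j < T" using c by auto
    then show "W_bar b T $$ (i, j) = 0"
      using wave_impulse_front[of "j + 1" "i + 1" b] \<open>j < i\<close> W_bar_entry[of i T j b] by simp
  qed
  show "W_bar b T $$ (i, i) = 1" if "i < T"
    using wave_impulse_front[of "i + 1" "i + 1" b] that W_bar_entry[of i T i b] by simp
qed

lemma W_bar_inverse:
  obtains K where "mat_inverse (W_bar b T) = Some K" "K \<in> carrier_mat T T"
    "W_bar b T * K = 1\<^sub>m T" "K * W_bar b T = 1\<^sub>m T"
proof -
  note W = W_bar_unitriangular[where b = b and T = T]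
  have "set (diag_mat (W_bar b T)) \<subseteq> {1}" using W by (auto simp: diag_mat_def)
  then have "det (W_bar b T) \<noteq> 0"
    unfolding det_upper_triangular[OF W(2,1)] by (auto simp: prod_list_zero_iff)
  then have "mat_inverse (W_bar b T) \<noteq> None"
    using det_non_zero_imp_unit[OF W(1), of undefined] mat_inverse(1)[OF W(1), of undefined] by blast
  then obtain K where "mat_inverse (W_bar b T) = Some K" by auto
  with mat_inverse(2)[OF W(1) this] that show thesis by blast
qed

end

theory Submission
  imports Defs
begin

text \<open>The matrix \<open>C_bar\<close> is the Gram matrix of the columns of \<open>W_bar\<close>, that is,
  \<open>C_bar = W_bar\<^sup>T W_bar\<close>. Multiplying by \<open>K = W_bar\<^sup>-\<^sup>1\<close> gives \<open>C_bar K = W_bar\<^sup>T\<close>, which is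
  lower triangular. The claim says that the last column of \<open>C_bar K\<close> vanishes above the diagonal:
  the last column of \<open>K\<close> consists of the numbers \<open>k_tilde b T j (T - 1)\<close> followed by a \<open>1\<close>, and
  splitting off the identity from \<open>C_bar\<close> produces the term outside the sum.

  The Gram identity is the discrete Blagoveshchenskii identity. Let \<open>u\<close> be the impulse response,
  so that the columns of \<open>W_bar\<close> are the states of \<open>u\<close> at times \<open>1, \<dots>, T\<close>, and let \<open>G s t\<close> be the
  inner product of its states at times \<open>s\<close> and \<open>t\<close>. The spatial part of the equation is symmetric,
  so \<open>G\<close> itself satisfies the potential-free wave equation
  \<open>G (s + 1) t + G (s - 1) t = G s (t + 1) + G s (t - 1)\<close> for positive \<open>s\<close> and \<open>t\<close>.
  Equivalently, the diagonal increment \<open>G (s + 1) (t + 1) - G s t\<close> depends on \<open>s + t\<close> only. At \<open>s = 0\<close> it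
  equals \<open>response b t\<close>, because the state at time \<open>1\<close> is the first unit vector. Summing the
  increments along a diagonal gives the entries of \<open>C_bar\<close>.\<close>

text \<open>The sum telescopes to a discrete Wronskian at both ends. At the left end it vanishes since the
  impulse has left the boundary at positive times; at the right end it suffices that one of the two
  times lies below \<open>N\<close>, by finite speed of propagation. The asymmetric hypothesis serves the
  induction in \<open>impulse_gram_diagonal_step\<close>, where the other time runs beyond \<open>N\<close>.\<close>

lemma impulse_green_identity:
  fixes b :: "nat \<Rightarrow> real"
  assumes "Suc s < N"
  defines "u \<equiv> \<lambda>n t. wave b impulse n (int t)"
  shows "(\<Sum>n<N. (u (n + 2) (Suc s) + u n (Suc s)) * u (Suc n) (Suc t))
    = (\<Sum>n<N. u (Suc n) (Suc s) * (u (n + 2) (Suc t) + u n (Suc t)))"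
proof -
  have zero: "u 0 (Suc r) = 0" for r
    unfolding u_def by (simp only: wave_boundary) simp
  have telescope: "(\<Sum>n<M. (u (n + 2) (Suc s) + u n (Suc s)) * u (Suc n) (Suc t))
      - (\<Sum>n<M. u (Suc n) (Suc s) * (u (n + 2) (Suc t) + u n (Suc t)))
    = u (Suc M) (Suc s) * u M (Suc t) - u M (Suc s) * u (Suc M) (Suc t)" for M
    by (induction M) (simp_all add: zero distrib_left distrib_right mult.commute)
  have "u N (Suc s) = 0" "u (Suc N) (Suc s) = 0"
    using assms(1) wave_impulse_front[of "Suc s" N b] wave_impulse_front[of "Suc s" "Suc N" b]
    unfolding u_def by auto
  then show ?thesis using telescope[of N] by simp
qed

lemma impulse_step:
  "wave b impulse (Suc n) (int (Suc (Suc t))) =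
     wave b impulse (n + 2) (int (Suc t)) + wave b impulse n (int (Suc t))
     - b (Suc n) * wave b impulse (Suc n) (int (Suc t)) - wave b impulse (Suc n) (int t)"
  using wave_step[of "Suc n" b impulse "Suc t"] by simp

text \<open>Substituting the equation of motion in both factors, the potential terms cancel and Green's
  identity removes the neighbour terms; what remains is the potential-free wave equation for the
  Gram function. It moves the diagonal increment from \<open>(Suc s, t)\<close> to \<open>(s, Suc t)\<close>.\<close>

lemma impulse_gram_diagonal_step:
  fixes b :: "nat \<Rightarrow> real"
  assumes "s < N"
  defines "u \<equiv> \<lambda>n t. wave b impulse n (int t)"
  shows "(\<Sum>n<N. u (Suc n) (Suc s) * u (Suc n) (Suc t))
    = (\<Sum>n<N. u (Suc n) s * u (Suc n) t) + response b (s + t)"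
  using assms(1)
proof (induction s arbitrary: t)
  case 0
  have first: "u (Suc n) (Suc 0) = (if n = 0 then 1 else 0)" for n
    using wave_impulse_front[of 1 "Suc n" b] unfolding u_def by auto
  have initial: "u (Suc n) 0 = 0" for n
    unfolding u_def using wave_initial(2)[of "Suc n" b impulse] by simp
  have "(\<Sum>n<N. u (Suc n) (Suc 0) * u (Suc n) (Suc t))
      = (\<Sum>n<N. if n = 0 then u (Suc n) (Suc t) else 0)"
    by (rule sum.cong) (simp_all add: first)
  also have "\<dots> = u 1 (Suc t)" using 0 by simp
  also have "\<dots> = response b t" by (simp add: u_def response_def add.commute)
  finally show ?case by (simp add: initial)
next
  case (Suc s)
  have step: "u (Suc n) (Suc (Suc r))
      = u (n + 2) (Suc r) + u n (Suc r) - b (Suc n) * u (Suc n) (Suc r) - u (Suc n) r" for n r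
    unfolding u_def by (rule impulse_step)
  have "(\<Sum>n<N. (u (Suc n) (Suc (Suc s)) + u (Suc n) s) * u (Suc n) (Suc t))
      = (\<Sum>n<N. (u (n + 2) (Suc s) + u n (Suc s)) * u (Suc n) (Suc t))
        - (\<Sum>n<N. b (Suc n) * u (Suc n) (Suc s) * u (Suc n) (Suc t))"
    unfolding sum_subtractf[symmetric] by (rule sum.cong) (simp_all add: step algebra_simps)
  also have "\<dots> = (\<Sum>n<N. u (Suc n) (Suc s) * (u (n + 2) (Suc t) + u n (Suc t)))
        - (\<Sum>n<N. b (Suc n) * u (Suc n) (Suc s) * u (Suc n) (Suc t))"
    using impulse_green_identity[OF Suc.prems, of b t] by (simp only: u_def)
  also have "\<dots> = (\<Sum>n<N. u (Suc n) (Suc s) * (u (Suc n) (Suc (Suc t)) + u (Suc n) t))"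
    unfolding sum_subtractf[symmetric] by (rule sum.cong) (simp_all add: step algebra_simps)
  finally have
    "(\<Sum>n<N. u (Suc n) (Suc (Suc s)) * u (Suc n) (Suc t)) + (\<Sum>n<N. u (Suc n) s * u (Suc n) (Suc t))
     = (\<Sum>n<N. u (Suc n) (Suc s) * u (Suc n) (Suc (Suc t))) + (\<Sum>n<N. u (Suc n) (Suc s) * u (Suc n) t)"
    by (simp only: distrib_left distrib_right sum.distrib)
  then show ?case using Suc.IH[of "Suc t"] Suc.prems by simp
qed

text \<open>Summation of the increments along the diagonal through \<open>(s, t)\<close>, which starts on an axis,
  where the Gram function vanishes. The increments have the indices
  \<open>\<bar>s - t\<bar>, \<bar>s - t\<bar> + 2, \<dots>, s + t - 2\<close>.\<close>

lemma impulse_gram: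
  assumes "s \<le> N"
  shows "(\<Sum>n<N. wave b impulse (Suc n) (int s) * wave b impulse (Suc n) (int t))
    = (\<Sum>k<min s t. response b (nat \<bar>int s - int t\<bar> + 2 * k))"
  using assms
proof (induction s arbitrary: t)
  case 0
  then show ?case using wave_initial(2)[of "Suc _" b impulse] by simp
next
  case (Suc s)
  show ?case
  proof (cases t)
    case 0
    then show ?thesis using wave_initial(2)[of "Suc _" b impulse] by simp
  next
    case t: (Suc r)
    have "nat \<bar>int s - int r\<bar> + 2 * min s r = s + r" by linarith
    moreover have "int (Suc s) - int (Suc r) = int s - int r" by simp
    ultimately show ?thesis
      using impulse_gram_diagonal_step[of s N b r] Suc.IH[of r] Suc.prems
      by (simp only: t min_Suc_Suc sum.lessThan_Suc)
  qed
qed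

lemma C_bar_entry:
  assumes "i < T" "j < T"
  shows "C_bar b T $$ (i, j)
    = (\<Sum>k<min (Suc i) (Suc j). response b (nat \<bar>int (Suc i) - int (Suc j)\<bar> + 2 * k))"
proof -
  have max: "T - Suc (max (T - Suc j) (T - Suc i)) = min i j" using assms by linarith
  have diff: "\<bar>int (T - Suc j) - int (T - Suc i)\<bar> = \<bar>int i - int j\<bar>" using assms by linarith
  have "C_bar b T $$ (i, j) = (\<Sum>k = 0..T - Suc (max (T - Suc j) (T - Suc i)).
      response b (nat \<bar>int (T - Suc j) - int (T - Suc i)\<bar> + 2 * k))"
    using assms by (simp add: C_bar_def C_mat_def entry_def Let_def del: of_nat_diff)
  then show ?thesis unfolding max diff
    by (simp add: atLeast0AtMost lessThan_Suc_atMost)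
qed

lemma C_bar_eq_gram: "C_bar b T = transpose_mat (W_bar b T) * W_bar b T"
proof (rule eq_matI)
  note W = W_bar_unitriangular(1)[of b T]
  fix i j
  assume "i < dim_row (transpose_mat (W_bar b T) * W_bar b T)"
    and "j < dim_col (transpose_mat (W_bar b T) * W_bar b T)"
  then have ij: "i < T" "j < T" using W by auto
  have "(transpose_mat (W_bar b T) * W_bar b T) $$ (i, j)
      = (\<Sum>n<T. W_bar b T $$ (n, i) * W_bar b T $$ (n, j))"
    using W ij by (simp add: scalar_prod_def atLeast0LessThan)
  also have "\<dots> = (\<Sum>n<T. wave b impulse (Suc n) (int (Suc i)) * wave b impulse (Suc n) (int (Suc j)))"
    using ij by (intro sum.cong) (simp_all add: W_bar_entry)
  also have "\<dots> = C_bar b T $$ (i, j)"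
    unfolding C_bar_entry[OF ij] using ij by (intro impulse_gram) simp
  finally show "C_bar b T $$ (i, j) = (transpose_mat (W_bar b T) * W_bar b T) $$ (i, j)" by simp
qed (simp_all add: C_bar_def W_bar_def)

text \<open>The last row of the unitriangular matrix \<open>W_bar\<close> is the last unit vector, so the last row of
  \<open>W_bar K = 1\<close> reads off the last row of \<open>K\<close>.\<close>

lemma W_bar_inverse_corner:
  assumes "0 < T" and K: "K \<in> carrier_mat T T" and inv: "W_bar b T * K = 1\<^sub>m T"
  shows "K $$ (T - 1, T - 1) = 1"
proof -
  note W = W_bar_unitriangular[where b = b and T = T]
  have row: "W_bar b T $$ (T - 1, n) = (if n = T - 1 then 1 else 0)" if "n < T" for n
    using that W assms(1) upper_triangularD[OF W(2), of n "T - 1"] by auto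
  have "1 = (W_bar b T * K) $$ (T - 1, T - 1)" using inv assms(1) by simp
  also have "\<dots> = (\<Sum>n = 0..<T. W_bar b T $$ (T - 1, n) * K $$ (n, T - 1))"
    using W(1) K assms(1) by (simp add: scalar_prod_def)
  also have "\<dots> = (\<Sum>n = 0..<T. if n = T - 1 then K $$ (n, T - 1) else 0)"
    by (rule sum.cong) (simp_all add: row del: One_nat_def)
  also have "\<dots> = K $$ (T - 1, T - 1)" using assms(1) by simp
  finally show ?thesis by simp
qed

theorem theorem4:
  fixes b :: "nat \<Rightarrow> real" and T :: nat and \<beta> :: nat
  assumes "T \<ge> 2" and "1 \<le> \<beta>" and "\<beta> \<le> T - 1"
  shows "k_tilde b T \<beta> (T - 1)
      + (\<Sum>j = 1..T - 1. entry (C_tilde b T) \<beta> j * k_tilde b T j (T - 1))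
      + entry (C_tilde b T) \<beta> T = 0"
proof -
  note W = W_bar_unitriangular[where b = b and T = T]
  obtain K where K: "mat_inverse (W_bar b T) = Some K" "K \<in> carrier_mat T T"
    and inv: "W_bar b T * K = 1\<^sub>m T"
    by (rule W_bar_inverse)
  have C: "C_bar b T \<in> carrier_mat T T" by (simp add: C_bar_def)
  have range: "\<beta> - 1 < T" "T - 1 < T" "\<beta> - 1 < T - 1" using assms by auto
  have CK: "C_bar b T * K = transpose_mat (W_bar b T)"
    unfolding C_bar_eq_gram using W(1) K(2)
    by (simp add: assoc_mult_mat[of _ T T _ T _ T] inv right_mult_one_mat[of _ T T])
  have k: "k_tilde b T j (T - 1) = K $$ (j - 1, T - 1)" for j
    using assms(1) by (simp add: k_tilde_def K(1) entry_def)
  have c: "entry (C_tilde b T) \<beta> j = C_bar b T $$ (\<beta> - 1, j - 1) - (if j = \<beta> then 1 else 0)"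
    if "1 \<le> j" "j \<le> T" for j
    using that assms C by (auto simp: entry_def C_tilde_def)
  have "0 = (C_bar b T * K) $$ (\<beta> - 1, T - 1)"
    unfolding CK using W(1) range upper_triangularD[OF W(2), of "\<beta> - 1" "T - 1"] by auto
  also have "\<dots> = (\<Sum>n = 0..<T. C_bar b T $$ (\<beta> - 1, n) * K $$ (n, T - 1))"
    using C K(2) range by (simp add: scalar_prod_def)
  also have "\<dots> = (\<Sum>j = 1..T. C_bar b T $$ (\<beta> - 1, j - 1) * K $$ (j - 1, T - 1))"
    by (rule sum.reindex_bij_witness[of _ "\<lambda>j. j - 1" Suc]) auto
  also have "{1..T} = insert T {1..T - 1}" using assms(1) by auto
  also have "(\<Sum>j\<in>insert T {1..T - 1}. C_bar b T $$ (\<beta> - 1, j - 1) * K $$ (j - 1, T - 1))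
      = C_bar b T $$ (\<beta> - 1, T - 1)
        + (\<Sum>j = 1..T - 1. C_bar b T $$ (\<beta> - 1, j - 1) * K $$ (j - 1, T - 1))"
    using assms(1) W_bar_inverse_corner[OF _ K(2) inv] by simp
  finally have gram: "C_bar b T $$ (\<beta> - 1, T - 1)
      + (\<Sum>j = 1..T - 1. C_bar b T $$ (\<beta> - 1, j - 1) * K $$ (j - 1, T - 1)) = 0" by simp
  have "(\<Sum>j = 1..T - 1. entry (C_tilde b T) \<beta> j * k_tilde b T j (T - 1))
      = (\<Sum>j = 1..T - 1. C_bar b T $$ (\<beta> - 1, j - 1) * K $$ (j - 1, T - 1)
          - (if j = \<beta> then K $$ (j - 1, T - 1) else 0))"
  proof (rule sum.cong[OF refl])
    fix j assume "j \<in> {1..T - 1}"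
    then have "1 \<le> j" "j \<le> T" by auto
    then show "entry (C_tilde b T) \<beta> j * k_tilde b T j (T - 1)
      = C_bar b T $$ (\<beta> - 1, j - 1) * K $$ (j - 1, T - 1)
        - (if j = \<beta> then K $$ (j - 1, T - 1) else 0)"
      unfolding c[OF \<open>1 \<le> j\<close> \<open>j \<le> T\<close>] k left_diff_distrib by simp
  qed
  also have "\<dots> = (\<Sum>j = 1..T - 1. C_bar b T $$ (\<beta> - 1, j - 1) * K $$ (j - 1, T - 1))
      - K $$ (\<beta> - 1, T - 1)"
    using assms by (simp add: sum_subtractf)
  finally have sum: "(\<Sum>j = 1..T - 1. entry (C_tilde b T) \<beta> j * k_tilde b T j (T - 1))
      = (\<Sum>j = 1..T - 1. C_bar b T $$ (\<beta> - 1, j - 1) * K $$ (j - 1, T - 1)) - K $$ (\<beta> - 1, T - 1)" .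
  have "entry (C_tilde b T) \<beta> T = C_bar b T $$ (\<beta> - 1, T - 1)"
    using c[of T] assms by auto
  then show ?thesis using gram sum k[of \<beta>] by linarith
qed

end
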